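(* Let $n\ge1$ and $\alpha>0$. Let $X$ be any Banach space of entire functions in $\mathbb{C}^n$ satisfying: (a) for all $a\in\mathbb{C}^n$ and $f\in X$, one has $T_af\in X$ and $\|T_af\|_X=\|f\|_X$; (b) $f\mapsto f(0)$ is a bounded linear functional on $X$. Then $X\subset F^\infty_\alpha$ and the inclusion is continuous.
   Context: For $z=(z_1,\dots,z_n)$ and $a=(a_1,\dots,a_n)$ in $\mathbb{C}^n$ write $z\overline a=z_1\overline a_1+\cdots+z_n\overline a_n$ and $|z|^2=z\overline z$. The Fock space $F^\infty_\alpha$ is the space of all entire functions $f$ on $\mathbb{C}^n$ such that $\|f\|_{\infty,\alpha}=\sup_{z\in\mathbb{C}^n}|f(z)|e^{-\frac{\alpha}{2}|z|^2}<\infty$, with this norm. For $a\in\mathbb{C}^n$ the weighted translation operator $T_a$ acts on entire functions by $T_af(z)=e^{\alpha z\overline a-\frac{\alpha}{2}|a|^2}f(z-a)$. A Banach space of entire functions is a complex Banach space whose elements are entire functions on $\mathbb{C}^n$, with pointwise linear operations. *)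

theory Defs
  imports "HOL-Analysis.Analysis"
begin

definition herm :: "complex ^ 'n \<Rightarrow> complex ^ 'n \<Rightarrow> complex" where
  "herm z a = (\<Sum>i\<in>UNIV. z $ i * cnj (a $ i))"

text \<open>The library norm on \<^typ>\<open>complex ^ 'n\<close> is the Euclidean one.\<close>

lemma herm_self: "herm z z = complex_of_real ((norm z)\<^sup>2)"
proof -
  have "(norm z)\<^sup>2 = (\<Sum>i\<in>UNIV. (cmod (z $ i))\<^sup>2)"
    by (simp add: norm_vec_def L2_set_def sum_nonneg)
  then show ?thesis
    by (simp add: herm_def complex_norm_square[symmetric])
qed

text \<open>Holomorphy in several variables: Frechet differentiable everywhere, with a
  derivative that is linear over the complex numbers and not only over the reals.\<close>

definition entire :: "(complex ^ 'n \<Rightarrow> complex) \<Rightarrow> bool" where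
  "entire f \<longleftrightarrow>
     (\<forall>z. \<exists>L. (f has_derivative L) (at z) \<and> (\<forall>c v. L (c *s v) = c * L v))"

definition weighted_translation ::
  "real \<Rightarrow> complex ^ 'n \<Rightarrow> (complex ^ 'n \<Rightarrow> complex) \<Rightarrow> complex ^ 'n \<Rightarrow> complex" where
  "weighted_translation \<alpha> a f =
     (\<lambda>z. exp (of_real \<alpha> * herm z a - of_real (\<alpha> / 2 * (norm a)\<^sup>2)) * f (z - a))"

text \<open>A complex normed space of functions is given by its carrier \<open>X\<close> and a norm \<open>N\<close>,
  whose values outside \<open>X\<close> are irrelevant.\<close>

locale normed_function_space =
  fixes X :: "('a \<Rightarrow> complex) set" and N :: "('a \<Rightarrow> complex) \<Rightarrow> real"
  assumes zero_mem: "(\<lambda>z. 0) \<in> X"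
    and add_mem: "\<lbrakk>f \<in> X; g \<in> X\<rbrakk> \<Longrightarrow> (\<lambda>z. f z + g z) \<in> X"
    and scale_mem: "f \<in> X \<Longrightarrow> (\<lambda>z. c * f z) \<in> X"
    and norm_nonneg: "f \<in> X \<Longrightarrow> 0 \<le> N f"
    and norm_eq_zero: "f \<in> X \<Longrightarrow> N f = 0 \<longleftrightarrow> f = (\<lambda>z. 0)"
    and norm_triangle: "\<lbrakk>f \<in> X; g \<in> X\<rbrakk> \<Longrightarrow> N (\<lambda>z. f z + g z) \<le> N f + N g"
    and norm_scale: "f \<in> X \<Longrightarrow> N (\<lambda>z. c * f z) = cmod c * N f"

text \<open>The case distinction is needed because \<^locale>\<open>Metric_space\<close> requires symmetry and
  nonnegativity on the whole type.\<close>

definition norm_dist ::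
  "('a \<Rightarrow> complex) set \<Rightarrow> (('a \<Rightarrow> complex) \<Rightarrow> real) \<Rightarrow>
     ('a \<Rightarrow> complex) \<Rightarrow> ('a \<Rightarrow> complex) \<Rightarrow> real" where
  "norm_dist X N f g = (if f \<in> X \<and> g \<in> X then N (\<lambda>z. f z - g z) else 0)"

context normed_function_space
begin

lemma diff_mem: "\<lbrakk>f \<in> X; g \<in> X\<rbrakk> \<Longrightarrow> (\<lambda>z. f z - g z) \<in> X"
  using add_mem[of f "\<lambda>z. - 1 * g z"] scale_mem[of g "- 1"] by simp

lemma norm_minus_swap:
  assumes "f \<in> X" "g \<in> X"
  shows "N (\<lambda>z. f z - g z) = N (\<lambda>z. g z - f z)"
  using norm_scale[OF diff_mem[OF assms], of "- 1"] by simp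

sublocale Metric_space X "norm_dist X N"
proof
  show "0 \<le> norm_dist X N f g" for f g
    by (simp add: norm_dist_def diff_mem norm_nonneg)
  show "norm_dist X N f g = norm_dist X N g f" for f g
    using norm_minus_swap[of f g] by (auto simp: norm_dist_def)
  show "norm_dist X N f g = 0 \<longleftrightarrow> f = g" if "f \<in> X" "g \<in> X" for f g
    using that norm_eq_zero[OF diff_mem[OF that]] by (auto simp: norm_dist_def fun_eq_iff)
  show "norm_dist X N f h \<le> norm_dist X N f g + norm_dist X N g h"
    if "f \<in> X" "g \<in> X" "h \<in> X" for f g h
    using that norm_triangle[OF diff_mem[of f g] diff_mem[of g h]]
    by (simp add: norm_dist_def)
qed

end

locale banach_space_of_entire_functions = normed_function_space X N
  for X :: "(complex ^ 'n \<Rightarrow> complex) set" and N +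
  assumes entire_mem: "f \<in> X \<Longrightarrow> entire f"
    and complete: "mcomplete"

definition fock_norm :: "real \<Rightarrow> (complex ^ 'n \<Rightarrow> complex) \<Rightarrow> real" where
  "fock_norm \<alpha> f = (SUP z. cmod (f z) * exp (- (\<alpha> / 2) * (norm z)\<^sup>2))"

text \<open>Boundedness is stated explicitly because the supremum of an unbounded set of reals
  is unspecified.\<close>

definition fock_space :: "real \<Rightarrow> (complex ^ 'n \<Rightarrow> complex) set" where
  "fock_space \<alpha> =
     {f. entire f \<and> bdd_above (range (\<lambda>z. cmod (f z) * exp (- (\<alpha> / 2) * (norm z)\<^sup>2)))}"

lemma entire_zero: "entire (\<lambda>z. 0)"
  unfolding entire_def by (intro allI exI[of _ "\<lambda>v. 0"]) simp

lemma entire_add: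
  assumes "entire f" "entire g"
  shows "entire (\<lambda>z. f z + g z)"
  unfolding entire_def
proof
  fix z
  obtain L M where "(f has_derivative L) (at z)" "\<forall>c v. L (c *s v) = c * L v"
    "(g has_derivative M) (at z)" "\<forall>c v. M (c *s v) = c * M v"
    using assms unfolding entire_def by meson
  then show "\<exists>L. ((\<lambda>z. f z + g z) has_derivative L) (at z) \<and> (\<forall>c v. L (c *s v) = c * L v)"
    by (intro exI[of _ "\<lambda>v. L v + M v"]) (auto intro: has_derivative_add simp: distrib_left)
qed

lemma entire_scale:
  assumes "entire f"
  shows "entire (\<lambda>z. c * f z)"
  unfolding entire_def
proof
  fix z
  obtain L where "(f has_derivative L) (at z)" "\<forall>c v. L (c *s v) = c * L v"
    using assms unfolding entire_def by meson
  then show "\<exists>L. ((\<lambda>z. c * f z) has_derivative L) (at z) \<and> (\<forall>c v. L (c *s v) = c * L v)"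
    by (intro exI[of _ "\<lambda>v. c * L v"]) (auto intro: has_derivative_mult_right)
qed

lemma fock_normed_function_space:
  "normed_function_space (fock_space \<alpha> :: (complex ^ 'n \<Rightarrow> complex) set) (fock_norm \<alpha>)"
proof -
  define w :: "complex ^ 'n \<Rightarrow> real" where "w z = exp (- (\<alpha> / 2) * (norm z)\<^sup>2)" for z
  have w_pos: "w z > 0" for z
    by (simp add: w_def)
  have mem: "f \<in> fock_space \<alpha> \<longleftrightarrow> entire f \<and> (\<exists>B. \<forall>z. cmod (f z) * w z \<le> B)" for f :: "complex ^ 'n \<Rightarrow> complex"
    by (auto simp: fock_space_def bdd_above_def w_def)
  have nrm: "fock_norm \<alpha> f = (SUP z. cmod (f z) * w z)" for f :: "complex ^ 'n \<Rightarrow> complex"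
    by (simp add: fock_norm_def w_def)
  have upper: "cmod (f z) * w z \<le> fock_norm \<alpha> f" if "f \<in> fock_space \<alpha>" for f :: "complex ^ 'n \<Rightarrow> complex" and z
    unfolding nrm using that by (intro cSUP_upper) (auto simp: fock_space_def w_def)
  have least: "fock_norm \<alpha> f \<le> B" if "\<And>z. cmod (f z) * w z \<le> B" for f :: "complex ^ 'n \<Rightarrow> complex" and B
    unfolding nrm using that by (intro cSUP_least) auto
  have add_bound: "cmod (f z + g z) * w z \<le> cmod (f z) * w z + cmod (g z) * w z" for f g :: "complex ^ 'n \<Rightarrow> complex" and z
    using mult_right_mono[OF norm_triangle_ineq[of "f z" "g z"], of "w z"] w_pos[of z]
    by (simp add: distrib_right)
  have scale_in: "(\<lambda>z. c * f z) \<in> fock_space \<alpha>" if "f \<in> fock_space \<alpha>" for c and f :: "complex ^ 'n \<Rightarrow> complex"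
  proof -
    have "cmod (c * f z) * w z \<le> cmod c * fock_norm \<alpha> f" for z
      using mult_left_mono[OF upper[OF that, of z], of "cmod c"] by (simp add: norm_mult mult.assoc)
    then show ?thesis
      using that entire_scale unfolding mem by blast
  qed
  have scale_le: "fock_norm \<alpha> (\<lambda>z. c * f z) \<le> cmod c * fock_norm \<alpha> f"
    if "f \<in> fock_space \<alpha>" for c and f :: "complex ^ 'n \<Rightarrow> complex"
    using mult_left_mono[OF upper[OF that], of "cmod c"]
    by (intro least) (simp add: norm_mult mult.assoc)
  have nonneg: "0 \<le> fock_norm \<alpha> f" if "f \<in> fock_space \<alpha>" for f :: "complex ^ 'n \<Rightarrow> complex"
    using upper[OF that, of 0] w_pos[of 0] by (meson order_trans mult_nonneg_nonneg norm_ge_zero less_imp_le)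
  show ?thesis
  proof
    show "(\<lambda>z :: complex ^ 'n. 0) \<in> fock_space \<alpha>"
      by (auto simp: mem entire_zero w_pos)
  next
    fix f g :: "complex ^ 'n \<Rightarrow> complex"
    assume fg: "f \<in> fock_space \<alpha>" "g \<in> fock_space \<alpha>"
    have le: "cmod (f z + g z) * w z \<le> fock_norm \<alpha> f + fock_norm \<alpha> g" for z
      using add_bound[of f z g] upper[OF fg(1), of z] upper[OF fg(2), of z] by linarith
    show "(\<lambda>z. f z + g z) \<in> fock_space \<alpha>"
      using fg le entire_add unfolding mem by blast
    show "fock_norm \<alpha> (\<lambda>z. f z + g z) \<le> fock_norm \<alpha> f + fock_norm \<alpha> g"
      using le by (rule least)
  next
    fix f :: "complex ^ 'n \<Rightarrow> complex" and c
    assume f: "f \<in> fock_space \<alpha>"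
    show "(\<lambda>z. c * f z) \<in> fock_space \<alpha>"
      by (rule scale_in[OF f])
    show "0 \<le> fock_norm \<alpha> f"
      by (rule nonneg[OF f])
    show zero: "fock_norm \<alpha> f = 0 \<longleftrightarrow> f = (\<lambda>z. 0)"
    proof
      assume "fock_norm \<alpha> f = 0"
      then have "cmod (f z) * w z \<le> 0" for z
        using upper[OF f, of z] by simp
      then show "f = (\<lambda>z. 0)"
        using w_pos by (auto simp: fun_eq_iff mult_le_0_iff not_le[symmetric])
    qed (simp add: nrm)
    show "fock_norm \<alpha> (\<lambda>z. c * f z) = cmod c * fock_norm \<alpha> f"
    proof (cases "c = 0")
      case True
      then show ?thesis by (simp add: nrm)
    next
      case False
      then have "fock_norm \<alpha> f \<le> fock_norm \<alpha> (\<lambda>z. c * f z) / cmod c"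
        using scale_le[OF scale_in[OF f, of c], of "inverse c"]
        by (simp add: norm_inverse divide_inverse mult.assoc[symmetric] mult.commute)
      then have "cmod c * fock_norm \<alpha> f \<le> fock_norm \<alpha> (\<lambda>z. c * f z)"
        using False by (simp add: pos_le_divide_eq mult.commute)
      with scale_le[OF f, of c] show ?thesis by simp
    qed
  qed
qed

definition norm_topology ::
  "('a \<Rightarrow> complex) set \<Rightarrow> (('a \<Rightarrow> complex) \<Rightarrow> real) \<Rightarrow> ('a \<Rightarrow> complex) topology" where
  "norm_topology X N = Metric_space.mtopology X (norm_dist X N)"

text \<open>Linearity is not required below: evaluation is always linear on a space with
  pointwise operations.\<close>

definition bounded_eval_zero ::
  "(complex ^ 'n \<Rightarrow> complex) set \<Rightarrow> ((complex ^ 'n \<Rightarrow> complex) \<Rightarrow> real) \<Rightarrow> bool" where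
  "bounded_eval_zero X N \<longleftrightarrow> (\<exists>C. \<forall>f\<in>X. cmod (f 0) \<le> C * N f)"

end

theory Submission
  imports Defs
begin

text \<open>Translation carries every point to the origin at the cost of exactly the Fock weight:
  the value of \<open>weighted_translation \<alpha> (- z) f\<close> at 0 is f(z) times
  exp(-(\<alpha>/2)|z|^2) (\<open>weighted_translation_uminus_zero\<close>). Bounded evaluation at 0
  and invariance of the norm therefore bound |f(z)| exp(-(\<alpha>/2)|z|^2) by C times
  \<open>N f\<close>, uniformly in z. Taking the supremum gives membership in the Fock space and a
  norm estimate, which \<open>continuous_map_norm_topology_bounded\<close> turns into continuity of
  the inclusion.\<close>

lemma continuous_map_norm_topology_bounded:
  assumes X: "normed_function_space X N" and Y: "normed_function_space Y M"
    and sub: "X \<subseteq> Y" and le: "\<And>f. f \<in> X \<Longrightarrow> M f \<le> C * N f"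
  shows "continuous_map (norm_topology X N) (norm_topology Y M) (\<lambda>f. f)"
proof -
  interpret X: normed_function_space X N by (rule X)
  interpret Y: normed_function_space Y M by (rule Y)
  \<comment> \<open>C may be zero or negative; a strictly positive constant is needed to divide
    \<epsilon> by it.\<close>
  have pos: "0 < \<bar>C\<bar> + 1" by simp
  have le': "M f \<le> (\<bar>C\<bar> + 1) * N f" if "f \<in> X" for f
  proof -
    have "C * N f \<le> (\<bar>C\<bar> + 1) * N f"
      by (rule mult_right_mono) (use X.norm_nonneg[OF that] in auto)
    with le[OF that] show ?thesis by linarith
  qed
  \<comment> \<open>Operations are pointwise in both spaces, so the norm bound applied to the
    difference of a and x makes the inclusion Lipschitz.\<close>
  have small: "norm_dist Y M a x < \<epsilon>"
    if "a \<in> X" "x \<in> X" "norm_dist X N a x < \<epsilon> / (\<bar>C\<bar> + 1)" for a x \<epsilon>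
  proof -
    have "N (\<lambda>z. a z - x z) < \<epsilon> / (\<bar>C\<bar> + 1)"
      using that by (simp add: norm_dist_def)
    then have "(\<bar>C\<bar> + 1) * N (\<lambda>z. a z - x z) < \<epsilon>"
      using pos by (simp add: pos_less_divide_eq mult.commute)
    then show ?thesis
      using le'[OF X.diff_mem[of a x]] that sub by (auto simp: norm_dist_def)
  qed
  show ?thesis
    unfolding norm_topology_def X.metric_continuous_map[OF Y.Metric_space_axioms]
  proof (intro conjI ballI allI impI)
    fix a and \<epsilon> :: real
    assume "a \<in> X" "0 < \<epsilon>"
    then show "\<exists>\<delta>>0. \<forall>x. x \<in> X \<and> norm_dist X N a x < \<delta> \<longrightarrow> norm_dist Y M a x < \<epsilon>"
      using small pos by (intro exI[of _ "\<epsilon> / (\<bar>C\<bar> + 1)"]) auto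
  qed (use sub in auto)
qed

text \<open>At the origin the \<open>herm\<close> term vanishes, so only the Gaussian factor
  survives; it is the weight in \<open>fock_norm\<close>.\<close>

lemma weighted_translation_uminus_zero:
  "weighted_translation \<alpha> (- z) f 0 = exp (of_real (- (\<alpha> / 2) * (norm z)\<^sup>2)) * f z"
  by (simp add: weighted_translation_def herm_def)

theorem proposition4:
  fixes \<alpha> :: real
    and X :: "(complex ^ 'n \<Rightarrow> complex) set"
    and N :: "(complex ^ 'n \<Rightarrow> complex) \<Rightarrow> real"
  assumes "\<alpha> > 0"
    and "banach_space_of_entire_functions X N"
    and "\<And>a f. f \<in> X \<Longrightarrow>
           weighted_translation \<alpha> a f \<in> X \<and> N (weighted_translation \<alpha> a f) = N f"
    and "bounded_eval_zero X N"
  shows "X \<subseteq> fock_space \<alpha> \<and>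
         continuous_map (norm_topology X N) (norm_topology (fock_space \<alpha>) (fock_norm \<alpha>)) (\<lambda>f. f)"
proof -
  interpret X: banach_space_of_entire_functions X N by (rule assms(2))
  obtain C where C: "\<And>f. f \<in> X \<Longrightarrow> cmod (f 0) \<le> C * N f"
    using assms(4) unfolding bounded_eval_zero_def by blast
  have bound: "cmod (f z) * exp (- (\<alpha> / 2) * (norm z)\<^sup>2) \<le> C * N f" if "f \<in> X" for f z
  proof -
    \<comment> \<open>The translate has the same norm as f, so the bound does not depend on
      z.\<close>
    have "cmod (weighted_translation \<alpha> (- z) f 0) \<le> C * N f"
      using C assms(3)[OF that] by metis
    then show ?thesis
      unfolding weighted_translation_uminus_zero
      by (simp only: norm_mult norm_exp_eq_Re Re_complex_of_real mult.commute)
  qed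
  have sub: "X \<subseteq> fock_space \<alpha>"
    using X.entire_mem bound unfolding fock_space_def bdd_above_def by blast
  have "fock_norm \<alpha> f \<le> C * N f" if "f \<in> X" for f
    unfolding fock_norm_def using bound[OF that] by (intro cSUP_least) auto
  then show ?thesis
    using sub continuous_map_norm_topology_bounded[OF X.normed_function_space_axioms
        fock_normed_function_space sub] by blast
qed

end
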